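(* Let $n\ge 2$. There exist a vector field $b\in L^\infty\cap C^\infty(\mathbb{R}^n)$ and a nontrivial function $f\in L^\infty\cap C^\infty(\mathbb{R}^n)$ such that, for each $R\ge1$ and each $q$ with $n<q\le\infty$, $$\min\Bigl\{\|\nabla u\|_{L^\infty(\partial B_R)},\ \frac{u}{d}(0)\Bigr\}\ \ge\ e^{\hat c_0R}\ \ge\ c_0\,e^{c_0M_0R}\,R^{1-n/q}\,\|f\|_{L^q(B_R)},$$ where $u>0$ is the classical solution of $\Delta u+b\cdot\nabla u=f$ in $B_R$, $u=0$ on $\partial B_R$, and $M_0:=\|b\|_{L^\infty(B_R)}$. In addition, $c_1\le M_0\le C_1$ and $\|f\|_{L^q(B_R)}=C_2$. Here $c_0,\hat c_0,c_1,C_1,C_2>0$ depend only on $n$ and $q$ (and not on $R$).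
   Context: $B_R=\{x\in\mathbb{R}^n:|x|<R\}$ and $d(x)=\mathrm{dist}(x,\partial B_R)$, so $d(0)=R$. *)

theory Defs
  imports "HOL-Analysis.Analysis" "HOL-Probability.Essential_Supremum"
begin

text \<open>Intended for open \<open>S\<close>: \<open>Suc k\<close> asks for total differentiability on \<open>S\<close> and for every
  directional derivative to be \<open>C\<^sup>k\<close>, which by linearity of the derivative in the direction is
  the usual class \<open>C\<^sup>k\<^sup>+\<^sup>1\<close>.\<close>

primrec Ck_on ::
  "nat \<Rightarrow> 'a::real_normed_vector set \<Rightarrow> ('a \<Rightarrow> 'b::real_normed_vector) \<Rightarrow> bool" where
  "Ck_on 0 S f \<longleftrightarrow> continuous_on S f"
| "Ck_on (Suc k) S f \<longleftrightarrow>
     (\<forall>x\<in>S. f differentiable (at x)) \<and> (\<forall>v. Ck_on k S (\<lambda>x. frechet_derivative f (at x) v))"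

definition smooth_on ::
  "'a::real_normed_vector set \<Rightarrow> ('a \<Rightarrow> 'b::real_normed_vector) \<Rightarrow> bool" where
  "smooth_on S f \<longleftrightarrow> (\<forall>k. Ck_on k S f)"

definition grad :: "('a::euclidean_space \<Rightarrow> real) \<Rightarrow> 'a \<Rightarrow> 'a" where
  "grad u x = (\<Sum>i\<in>Basis. frechet_derivative u (at x) i *\<^sub>R i)"

definition laplacian :: "('a::euclidean_space \<Rightarrow> real) \<Rightarrow> 'a \<Rightarrow> real" where
  "laplacian u x =
     (\<Sum>i\<in>Basis. frechet_derivative (\<lambda>y. frechet_derivative u (at y) i) (at x) i)"

text \<open>The \<open>L\<^sup>q\<close> norm for \<open>0 < q \<le> \<infinity>\<close>. It is \<open>\<infinity>\<close> outside \<open>L\<^sup>q\<close>; for \<open>q = \<infinity>\<close> the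
  non-measurable case is covered by the convention of \<^const>\<open>esssup\<close>.\<close>

definition Lq_norm ::
  "'a measure \<Rightarrow> ennreal \<Rightarrow> ('a \<Rightarrow> 'b::real_normed_vector) \<Rightarrow> ennreal" where
  "Lq_norm M q g =
     (if q = \<infinity> then esssup M (\<lambda>x. ennreal (norm (g x)))
      else let I = (\<integral>\<^sup>+ x. ennreal (norm (g x) powr enn2real q) \<partial>M) in
        if g \<in> borel_measurable M \<and> I < \<infinity>
        then ennreal (enn2real I powr (1 / enn2real q)) else \<infinity>)"

definition L_infinity :: "('a::euclidean_space \<Rightarrow> 'b::real_normed_vector) \<Rightarrow> bool" where
  "L_infinity g \<longleftrightarrow> g \<in> borel_measurable lebesgue \<and> Lq_norm lebesgue \<infinity> g < \<infinity>"

text \<open>Surface measure on \<open>\<partial>B\<^sub>R\<close> via polar coordinates: a Borel set \<open>A\<close> of the sphere gets \<open>n / R\<close>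
  times the Lebesgue measure of the cone \<open>{t x | x \<in> A, 0 < t < 1}\<close>. The factor is
  \<open>area(\<partial>B\<^sub>R) / vol(B\<^sub>R)\<close>.\<close>

definition sphere_measure :: "real \<Rightarrow> 'a::euclidean_space measure" where
  "sphere_measure R =
     scale_measure (ennreal (real DIM('a) / R))
       (distr (lebesgue_on (ball 0 R - {0})) (restrict_space borel (sphere 0 R))
          (\<lambda>x. (R / norm x) *\<^sub>R x))"

definition classical_solution ::
  "real \<Rightarrow> ('a::euclidean_space \<Rightarrow> 'a) \<Rightarrow> ('a \<Rightarrow> real) \<Rightarrow> ('a \<Rightarrow> real) \<Rightarrow> bool" where
  "classical_solution R b f u \<longleftrightarrow>
     Ck_on 2 (ball 0 R) u \<and> continuous_on (cball 0 R) u \<and>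
     (\<forall>x\<in>ball 0 R. laplacian u x + b x \<bullet> grad u x = f x) \<and>
     (\<forall>x\<in>sphere 0 R. u x = 0)"

text \<open>Functions live on the whole space, so uniqueness is agreement on the closed ball.\<close>

definition unique_classical_solution ::
  "real \<Rightarrow> ('a::euclidean_space \<Rightarrow> 'a) \<Rightarrow> ('a \<Rightarrow> real) \<Rightarrow> ('a \<Rightarrow> real) \<Rightarrow> bool" where
  "unique_classical_solution R b f u \<longleftrightarrow>
     classical_solution R b f u \<and>
     (\<forall>v. classical_solution R b f v \<longrightarrow> (\<forall>x\<in>cball 0 R. v x = u x))"

text \<open>\<open>g\<close> is the continuous extension of \<open>\<nabla>u\<close> to the closed ball, so \<open>u\<close> is \<open>C\<^sup>1\<close> up to the boundary
  and \<open>g\<close> is \<open>\<nabla>u\<close> on \<open>\<partial>B\<^sub>R\<close>; \<open>g\<close> is determined by \<open>u\<close> on the closed ball if \<open>R > 0\<close>.\<close>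

definition grad_up_to_boundary ::
  "real \<Rightarrow> ('a::euclidean_space \<Rightarrow> real) \<Rightarrow> ('a \<Rightarrow> 'a) \<Rightarrow> bool" where
  "grad_up_to_boundary R u g \<longleftrightarrow>
     continuous_on (cball 0 R) g \<and> (\<forall>x\<in>ball 0 R. g x = grad u x)"

definition bdry_dist :: "real \<Rightarrow> 'a::euclidean_space \<Rightarrow> real" where
  "bdry_dist R x = infdist x (frontier (ball 0 R))"

end

theory Submission
  imports Defs "HOL-Real_Asymp.Real_Asymp"
begin

text \<open>The idea is to prescribe the solution and to compute the drift from it. Because \<open>b\<close> and \<open>f\<close> have to
  serve all radii at once, the solutions on different balls are taken to be one and the same radial
  function up to additive constants:
  \<open>u = A (exp (sqrt (1 + R\<^sup>2)) - exp \<langle>x\<rangle>)\<close> with \<open>\<langle>x\<rangle> = sqrt (1 + |x|\<^sup>2)\<close>.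
  It is smooth, positive in \<open>B\<^sub>R\<close>, zero on the sphere, and both \<open>|\<nabla>u|\<close> on the sphere and \<open>u(0) / R\<close>
  grow like \<open>exp R\<close> up to powers of \<open>R\<close>.

  A radial drift \<open>- \<beta> x\<close> enters the equation through \<open>\<beta> |x|\<^sup>2\<close> only. For \<open>x \<noteq> 0\<close> there is exactly one \<open>\<beta>\<close> that
  makes the right-hand side vanish, namely \<open>\<beta> = n/|x|\<^sup>2 + 1/\<langle>x\<rangle> - 1/\<langle>x\<rangle>\<^sup>2\<close>, and the resulting drift is bounded
  outside every neighbourhood of the origin. The singularity \<open>1/s\<close>, \<open>s = |x|\<^sup>2\<close>, is replaced by a smooth function that equals
  \<open>1/s\<close> for \<open>s \<ge> 1\<close>. This makes the drift smooth and bounded, and produces a source that is proportional to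
  the defect \<open>1 - s \<cdot> reg_inverse s\<close>. The defect is a bump function supported in the unit ball, so all
  \<open>L\<^sup>q\<close> norms of \<open>f\<close> over \<open>B\<^sub>R\<close>, \<open>R \<ge> 1\<close>, agree; see \<open>solution_pde\<close> and \<open>Lq_norm_ball_const\<close>.

  Uniqueness is the weak maximum principle for a bounded drift (\<open>weak_maximum_principle\<close>). Smoothness
  rests on closure of \<open>C\<^sup>k\<close> under products, inverses, square roots, exponentials and composition with
  flat functions. Finally, the drift is bounded independently of \<open>R\<close>, so for a small constant \<open>c0\<close> the
  quantity \<open>c0 exp (c0 M\<^sub>0 R) R \<parallel>f\<parallel>\<close> stays below \<open>exp (R/2)\<close> (\<open>exp_linear_growth_bound\<close>).\<close>

section \<open>Calculus of functions of class \<open>C\<^sup>k\<close>\<close>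

lemma Ck_on_subset: "Ck_on k T f \<Longrightarrow> S \<subseteq> T \<Longrightarrow> Ck_on k S f"
  by (induction k arbitrary: f) (auto intro: continuous_on_subset)

text \<open>On an open set the class \<open>C\<^sup>k\<close> depends only on the values there, so that any formula \<open>f'\<close> for the
  derivative on \<open>S\<close> may replace \<^const>\<open>frechet_derivative\<close>. The closure rules below rest on
  inductions on \<open>k\<close> through this rule.\<close>

lemma Ck_on_SucI:
  assumes "open S" and f': "\<And>x. x \<in> S \<Longrightarrow> (f has_derivative f' x) (at x)"
    and Ck: "\<And>v. Ck_on k S (\<lambda>x. f' x v)"
  shows "Ck_on (Suc k) S f"
proof -
  have cong: "Ck_on k S h" if "Ck_on k S g" "\<And>x. x \<in> S \<Longrightarrow> g x = h x"
    for k and g h :: "'a \<Rightarrow> 'b"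
    using that
  proof (induction k arbitrary: g h)
    case 0
    then show ?case by (simp cong: continuous_on_cong)
  next
    case (Suc k)
    have *: "(h has_derivative frechet_derivative g (at x)) (at x)" if "x \<in> S" for x
      using Suc.prems that \<open>open S\<close>
      by (intro has_derivative_transform_within_open[of g _ x UNIV S h])
        (auto simp: frechet_derivative_works[symmetric])
    have eq: "frechet_derivative g (at x) v = frechet_derivative h (at x) v" if "x \<in> S" for x v
      using frechet_derivative_at[OF *[OF that]] by simp
    show ?case
      using Suc.prems(1) * Suc.IH[OF _ eq] by (auto simp: differentiable_def)
  qed
  have "frechet_derivative f (at x) = f' x" if "x \<in> S" for x
    using frechet_derivative_at[OF f'[OF that]] by simp
  then have "Ck_on k S (\<lambda>x. frechet_derivative f (at x) v)" for v
    by (intro cong[OF Ck]) simp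
  then show ?thesis
    using f' by (auto simp: differentiable_def)
qed

lemma Ck_on_SucD:
  assumes "Ck_on (Suc k) S f"
  shows "Ck_on k S f"
    "x \<in> S \<Longrightarrow> (f has_derivative frechet_derivative f (at x)) (at x)"
    "Ck_on k S (\<lambda>x. frechet_derivative f (at x) v)"
proof -
  show "Ck_on k S f"
    using assms
  proof (induction k arbitrary: f)
    case 0
    have "continuous (at x) f" if "x \<in> S" for x
      using 0 that by (intro differentiable_imp_continuous_within) simp
    then show ?case
      by (simp add: continuous_at_imp_continuous_on)
  next
    case (Suc k)
    then show ?case by simp
  qed
  show "x \<in> S \<Longrightarrow> (f has_derivative frechet_derivative f (at x)) (at x)"
    "Ck_on k S (\<lambda>x. frechet_derivative f (at x) v)"
    using assms by (auto simp: frechet_derivative_works[symmetric])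
qed

lemma Ck_on_const: "open S \<Longrightarrow> Ck_on k S (\<lambda>x. c)"
proof (induction k arbitrary: c)
  case (Suc k)
  show ?case
    by (rule Ck_on_SucI[where f' = "\<lambda>x v. 0"]) (use Suc in auto)
qed auto

lemma Ck_on_bounded_linear:
  assumes "open S" "bounded_linear f"
  shows "Ck_on k S f"
proof (cases k)
  case 0
  then show ?thesis
    using assms by (simp add: bounded_linear.continuous_on[OF assms(2) continuous_on_id])
next
  case (Suc m)
  show ?thesis
    unfolding Suc
    by (rule Ck_on_SucI[where f' = "\<lambda>x. f"])
      (use assms in \<open>auto intro: bounded_linear_imp_has_derivative Ck_on_const\<close>)
qed

lemma Ck_on_add:
  assumes "open S" "Ck_on k S f" "Ck_on k S g"
  shows "Ck_on k S (\<lambda>x. f x + g x)"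
  using assms(2,3)
proof (induction k arbitrary: f g)
  case (Suc k)
  note D = Ck_on_SucD[OF Suc.prems(1)] Ck_on_SucD[OF Suc.prems(2)]
  show ?case
    by (rule Ck_on_SucI[OF assms(1) has_derivative_add[OF D(2) D(5)] Suc.IH[OF D(3) D(6)]])
qed (auto intro: continuous_intros)

lemma Ck_on_scaleR:
  fixes f :: "'a::real_normed_vector \<Rightarrow> real"
  assumes "open S" "Ck_on k S f" "Ck_on k S g"
  shows "Ck_on k S (\<lambda>x. f x *\<^sub>R g x)"
  using assms(2,3)
proof (induction k arbitrary: f g)
  case (Suc k)
  note D = Ck_on_SucD[OF Suc.prems(1)] Ck_on_SucD[OF Suc.prems(2)]
  show ?case
    by (rule Ck_on_SucI[OF assms(1) has_derivative_scaleR[OF D(2) D(5)]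
          Ck_on_add[OF assms(1) Suc.IH[OF D(1) D(6)] Suc.IH[OF D(3) D(4)]]])
qed (auto intro: continuous_intros)

lemma Ck_on_mult:
  fixes f g :: "'a::real_normed_vector \<Rightarrow> real"
  shows "open S \<Longrightarrow> Ck_on k S f \<Longrightarrow> Ck_on k S g \<Longrightarrow> Ck_on k S (\<lambda>x. f x * g x)"
  using Ck_on_scaleR[of S k f g] by simp

lemma Ck_on_minus:
  fixes f :: "'a::real_normed_vector \<Rightarrow> 'b::real_normed_vector"
  shows "open S \<Longrightarrow> Ck_on k S f \<Longrightarrow> Ck_on k S (\<lambda>x. - f x)"
  using Ck_on_scaleR[OF _ Ck_on_const, of S k f "-1"] by simp

lemma Ck_on_diff:
  fixes f :: "'a::real_normed_vector \<Rightarrow> 'b::real_normed_vector"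
  shows "open S \<Longrightarrow> Ck_on k S f \<Longrightarrow> Ck_on k S g \<Longrightarrow> Ck_on k S (\<lambda>x. f x - g x)"
  using Ck_on_add[OF _ _ Ck_on_minus, of S k f g] by simp

lemma Ck_on_inner_left:
  fixes a :: "'a::euclidean_space"
  shows "open S \<Longrightarrow> Ck_on k S (\<lambda>x. x \<bullet> a)"
  by (intro Ck_on_bounded_linear bounded_linear_inner_left)

lemma Ck_on_inner_self:
  fixes S :: "'a::euclidean_space set"
  assumes "open S"
  shows "Ck_on k S (\<lambda>x. x \<bullet> x)"
proof (cases k)
  case (Suc m)
  have "((\<lambda>x. x \<bullet> x) has_derivative (\<lambda>v. 2 * (x \<bullet> v))) (at x)" for x :: 'a
    by (auto intro!: derivative_eq_intros simp: inner_commute)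
  then show ?thesis
    unfolding Suc using assms
    by - (rule Ck_on_SucI[OF assms], assumption, intro Ck_on_mult Ck_on_const Ck_on_inner_left)
qed (auto intro: continuous_intros)

text \<open>The derivative of \<open>1/f\<close> is \<open>- (1/f) f' (1/f)\<close>, and the factor \<open>1/f\<close> is of class \<open>C\<^sup>k\<close> by induction. The
  exponential and the square root work in the same way, since their derivatives are \<open>exp f \<cdot> f'\<close> and
  \<open>f' / (2 sqrt f)\<close>.\<close>

lemma Ck_on_inverse:
  fixes f :: "'a::real_normed_vector \<Rightarrow> real"
  assumes "open S" "Ck_on k S f" "\<And>x. x \<in> S \<Longrightarrow> f x \<noteq> 0"
  shows "Ck_on k S (\<lambda>x. inverse (f x))"
  using assms(2)
proof (induction k)
  case (Suc k)
  note D = Ck_on_SucD[OF Suc.prems]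
  show ?case
    by (rule Ck_on_SucI[OF assms(1) Deriv.has_derivative_inverse[OF assms(3) D(2)]])
      (use Suc.IH D(1,3) assms(1) in \<open>auto intro!: Ck_on_mult Ck_on_minus\<close>)
qed (use assms(3) in \<open>auto intro: continuous_intros\<close>)

lemma Ck_on_exp:
  fixes f :: "'a::real_normed_vector \<Rightarrow> real"
  assumes "open S" "Ck_on k S f"
  shows "Ck_on k S (\<lambda>x. exp (f x))"
  using assms(2)
proof (induction k)
  case (Suc k)
  note D = Ck_on_SucD[OF Suc.prems]
  have "((\<lambda>x. exp (f x)) has_derivative (\<lambda>v. exp (f x) * frechet_derivative f (at x) v)) (at x)"
    if "x \<in> S" for x
    using D(2)[OF that] by (auto intro!: derivative_eq_intros)
  then show ?case
    using Suc.IH[OF D(1)] D(3) by - (rule Ck_on_SucI[OF assms(1)], assumption, intro Ck_on_mult assms(1))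
qed (auto intro: continuous_intros)

lemma Ck_on_sqrt:
  fixes f :: "'a::real_normed_vector \<Rightarrow> real"
  assumes "open S" "Ck_on k S f" "\<And>x. x \<in> S \<Longrightarrow> f x > 0"
  shows "Ck_on k S (\<lambda>x. sqrt (f x))"
  using assms(2)
proof (induction k)
  case (Suc k)
  note D = Ck_on_SucD[OF Suc.prems]
  have "((\<lambda>x. sqrt (f x)) has_derivative
      (\<lambda>v. inverse (sqrt (f x)) * (1/2 * frechet_derivative f (at x) v))) (at x)"
    if "x \<in> S" for x
    using D(2)[OF that] assms(3)[OF that] by (auto intro!: derivative_eq_intros simp: field_simps)
  moreover have "sqrt (f x) \<noteq> 0" if "x \<in> S" for x
    using assms(3)[OF that] by simp
  ultimately show ?case
    using Suc.IH[OF D(1)] D(3)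
    by - (rule Ck_on_SucI[OF assms(1)], assumption, intro Ck_on_mult Ck_on_inverse Ck_on_const assms(1))
qed (auto intro: continuous_intros)

section \<open>Functions that are flat at the origin\<close>

text \<open>The derivatives of \<open>exp (-1/t)\<close> are combinations of the functions \<open>exp (-1/t) / t\<^sup>m\<close>; extended by \<open>0\<close>
  to \<open>t \<le> 0\<close>, these form a family that is closed under differentiation.\<close>

definition flat :: "nat \<Rightarrow> real \<Rightarrow> real" where
  "flat m t = (if t > 0 then exp (- 1 / t) / t ^ m else 0)"

lemma flat_has_derivative:
  "(flat m has_real_derivative flat (m + 2) t - of_nat m * flat (m + 1) t) (at t)"
proof -
  consider "t > 0" | "t = 0" | "t < 0" by linarith
  then show ?thesis
  proof cases
    case 1
    have pow: "t ^ k = t * t ^ (k - Suc 0)" if "k \<noteq> 0" for k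
      using that by (cases k) auto
    have "((\<lambda>t. exp (- 1 / t) / t ^ m) has_real_derivative
        flat (m + 2) t - of_nat m * flat (m + 1) t) (at t)"
      using 1 pow[of m]
      by (cases "m = 0") (auto intro!: derivative_eq_intros simp: flat_def field_simps power2_eq_square)
    then show ?thesis
      by (rule has_field_derivative_transform_within_open[of _ _ _ "{0<..}"])
        (use 1 in \<open>auto simp: flat_def\<close>)
  next
    case 2
    \<comment> \<open>For \<open>h > 0\<close> the difference quotient at \<open>0\<close> is \<^term>\<open>flat (m + 1) h\<close>.\<close>
    have right: "((\<lambda>h. flat m h / h) \<longlongrightarrow> 0) (at_right 0)"
    proof (rule Lim_transform_eventually)
      show "((\<lambda>h::real. exp (- 1 / h) / h ^ m / h) \<longlongrightarrow> 0) (at_right 0)"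
        by real_asymp
      show "\<forall>\<^sub>F h in at_right 0. exp (- 1 / h) / h ^ m / h = flat m h / h"
        by (auto simp: flat_def eventually_at_right_less eventually_at_filter)
    qed
    have left: "((\<lambda>h. flat m h / h) \<longlongrightarrow> 0) (at_left 0)"
      by (rule Lim_transform_eventually[of "\<lambda>_. 0"])
        (auto simp: flat_def eventually_at_filter)
    have zero: "flat k 0 = 0" for k by (simp add: flat_def)
    have "(flat m has_real_derivative 0) (at 0)"
      using filterlim_split_at[OF left right] by (simp add: DERIV_def zero)
    then show ?thesis using 2 by (simp add: zero)
  next
    case 3
    have "((\<lambda>t. 0) has_real_derivative 0) (at t)" by simp
    then have "(flat m has_real_derivative 0) (at t)"
      by (rule has_field_derivative_transform_within_open[of _ _ _ "{..<0}"])
        (use 3 in \<open>auto simp: flat_def\<close>)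
    then show ?thesis using 3 by (simp add: flat_def)
  qed
qed

text \<open>The induction on \<open>k\<close> runs over all \<open>m\<close> at once, because differentiation raises \<open>m\<close>.\<close>

lemma Ck_on_flat:
  fixes f :: "'a::real_normed_vector \<Rightarrow> real"
  assumes "open S" "Ck_on k S f"
  shows "Ck_on k S (\<lambda>x. flat m (f x))"
  using assms(2)
proof (induction k arbitrary: m)
  case 0
  have "continuous_on UNIV (flat m)"
    using DERIV_isCont[OF flat_has_derivative] by (auto simp: continuous_on_eq_continuous_at)
  with 0 show ?case
    using continuous_on_compose2[of UNIV "flat m" S f] by simp
next
  case (Suc k)
  note D = Ck_on_SucD[OF Suc.prems]
  have "((\<lambda>x. flat m (f x)) has_derivative
      (\<lambda>v. frechet_derivative f (at x) v * (flat (m + 2) (f x) - of_nat m * flat (m + 1) (f x)))) (at x)"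
    if "x \<in> S" for x
    by (rule DERIV_compose_FDERIV[OF flat_has_derivative D(2)[OF that]])
  then show ?case
    using Suc.IH[OF D(1)] D(3)
    by - (rule Ck_on_SucI[OF assms(1)], assumption, intro Ck_on_mult Ck_on_diff Ck_on_const assms(1))
qed

section \<open>The weak maximum principle and uniqueness\<close>

text \<open>The gradient and the Laplacian of a function are read off from a field \<open>G\<close> that represents its
  derivative near \<open>x\<close>; the Laplacian is then the divergence of \<open>G\<close>.\<close>

lemma grad_laplacian_eqI:
  fixes f :: "'a::euclidean_space \<Rightarrow> real"
  assumes "open S" "x \<in> S"
    and G: "\<And>y. y \<in> S \<Longrightarrow> (f has_derivative (\<lambda>v. G y \<bullet> v)) (at y)"
    and D: "\<And>i. i \<in> Basis \<Longrightarrow> ((\<lambda>y. G y \<bullet> i) has_derivative D i) (at x)"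
  shows "grad f x = G x" "laplacian f x = (\<Sum>i\<in>Basis. D i i)"
proof -
  have eq: "frechet_derivative f (at y) = (\<lambda>v. G y \<bullet> v)" if "y \<in> S" for y
    using frechet_derivative_at[OF G[OF that]] by simp
  show "grad f x = G x"
    unfolding grad_def eq[OF assms(2)] by (rule euclidean_representation)
  have "((\<lambda>y. frechet_derivative f (at y) i) has_derivative D i) (at x)" if "i \<in> Basis" for i
    by (rule has_derivative_transform_within_open[OF D[OF that] assms(1,2)]) (simp only: eq)
  then have "frechet_derivative (\<lambda>y. frechet_derivative f (at y) i) (at x) = D i" if "i \<in> Basis" for i
    using frechet_derivative_at that by metis
  then show "laplacian f x = (\<Sum>i\<in>Basis. D i i)"
    unfolding laplacian_def by (intro sum.cong refl) (simp only:)
qed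

lemma has_derivative_grad:
  assumes "f differentiable (at x)"
  shows "(f has_derivative (\<lambda>v. grad f x \<bullet> v)) (at x)"
proof -
  have d: "(f has_derivative frechet_derivative f (at x)) (at x)"
    using assms by (simp add: frechet_derivative_works[symmetric])
  have "frechet_derivative f (at x) v = grad f x \<bullet> v" for v
  proof -
    have "frechet_derivative f (at x) v
        = frechet_derivative f (at x) (\<Sum>i\<in>Basis. (v \<bullet> i) *\<^sub>R i)"
      by (simp add: euclidean_representation)
    also have "\<dots> = (\<Sum>i\<in>Basis. (v \<bullet> i) *\<^sub>R frechet_derivative f (at x) i)"
      by (simp add: linear_sum[OF has_derivative_linear[OF d]] linear_scale[OF has_derivative_linear[OF d]])
    also have "\<dots> = grad f x \<bullet> v"
      unfolding grad_def inner_sum_left inner_scaleR_left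
      by (intro sum.cong) (simp_all add: inner_commute mult.commute)
    finally show ?thesis .
  qed
  then have "frechet_derivative f (at x) = (\<lambda>v. grad f x \<bullet> v)" by blast
  with d show ?thesis by simp
qed

lemma grad_inner_has_derivative:
  fixes f :: "'a::euclidean_space \<Rightarrow> real"
  assumes "open S" "Ck_on 2 S f" "x \<in> S"
  shows "((\<lambda>y. grad f y \<bullet> i) has_derivative
      frechet_derivative (\<lambda>y. frechet_derivative f (at y) i) (at x)) (at x)"
proof -
  have *: "\<forall>y\<in>S. f differentiable (at y)"
    "(\<lambda>y. frechet_derivative f (at y) i) differentiable (at x)"
    using assms by (auto simp: numeral_2_eq_2)
  have "frechet_derivative f (at y) i = grad f y \<bullet> i" if "y \<in> S" for y
    using fun_cong[OF frechet_derivative_at[OF has_derivative_grad[of f y]], of i] *(1) that by simp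
  then show ?thesis
    by (rule has_derivative_transform_within_open[OF
          *(2)[unfolded frechet_derivative_works] assms(1,3)])
qed

lemma grad_laplacian_add_cmult:
  fixes f g :: "'a::euclidean_space \<Rightarrow> real"
  assumes "open S" "Ck_on 2 S f" "Ck_on 2 S g" "x \<in> S"
  shows "grad (\<lambda>y. f y + c * g y) x = grad f x + c *\<^sub>R grad g x"
    and "laplacian (\<lambda>y. f y + c * g y) x = laplacian f x + c * laplacian g x"
proof -
  have deriv: "((\<lambda>y. f y + c * g y) has_derivative (\<lambda>v. (grad f y + c *\<^sub>R grad g y) \<bullet> v)) (at y)"
    if "y \<in> S" for y
  proof -
    have "f differentiable (at y)" "g differentiable (at y)"
      using assms that by (auto simp: numeral_2_eq_2)
    then show ?thesis
      unfolding inner_add_left inner_scaleR_left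
      by (intro has_derivative_add has_derivative_mult_right has_derivative_grad)
  qed
  define D where "D h i = frechet_derivative (\<lambda>y. frechet_derivative h (at y) i) (at x)"
    for h :: "'a \<Rightarrow> real" and i
  have deriv2: "((\<lambda>y. (grad f y + c *\<^sub>R grad g y) \<bullet> i) has_derivative
      (\<lambda>v. D f i v + c * D g i v)) (at x)" for i
    unfolding inner_add_left inner_scaleR_left D_def
    by (rule has_derivative_add[OF grad_inner_has_derivative[OF assms(1,2,4)]
          has_derivative_mult_right[OF grad_inner_has_derivative[OF assms(1,3,4)]]])
  show "grad (\<lambda>y. f y + c * g y) x = grad f x + c *\<^sub>R grad g x"
    by (rule grad_laplacian_eqI(1)[OF assms(1,4) deriv deriv2])
  have "laplacian (\<lambda>y. f y + c * g y) x = (\<Sum>i\<in>Basis. D f i i + c * D g i i)"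
    by (rule grad_laplacian_eqI(2)[OF assms(1,4) deriv deriv2])
  then show "laplacian (\<lambda>y. f y + c * g y) x = laplacian f x + c * laplacian g x"
    by (simp only: laplacian_def D_def sum.distrib sum_distrib_left)
qed

text \<open>If the second derivative were positive, the first one would be positive just to the right of the
  maximum and the function would increase there.\<close>

lemma second_derivative_nonpos_at_local_max:
  fixes \<psi> D :: "real \<Rightarrow> real"
  assumes "d > 0"
    and D: "\<And>t. \<bar>t\<bar> < d \<Longrightarrow> (\<psi> has_real_derivative D t) (at t)"
    and c: "(D has_real_derivative c) (at 0)"
    and max: "\<And>t. \<bar>t\<bar> < d \<Longrightarrow> \<psi> t \<le> \<psi> 0"
  shows "D 0 = 0" "c \<le> 0"
proof -
  show "D 0 = 0"
    using DERIV_local_max[OF D[of 0] \<open>d > 0\<close>] max \<open>d > 0\<close> by simp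
  show "c \<le> 0"
  proof (rule ccontr)
    assume "\<not> c \<le> 0"
    then obtain e where e: "e > 0" "\<And>h. 0 < h \<Longrightarrow> h < e \<Longrightarrow> D 0 < D h"
      using DERIV_pos_inc_right[OF c] by auto
    define h where "h = min d e / 2"
    have h: "0 < h" "h < d" "h < e"
      using e(1) \<open>d > 0\<close> by (auto simp: h_def min_def)
    have "\<psi> 0 < \<psi> h"
    proof (rule DERIV_pos_imp_increasing_open[OF h(1)])
      show "\<exists>y. (\<psi> has_real_derivative y) (at t) \<and> y > 0" if "0 < t" "t < h" for t
        using e(2)[of t] D[of t] that h \<open>D 0 = 0\<close> by auto
      show "continuous_on {0..h} \<psi>"
        using D h by (intro continuous_at_imp_continuous_on ballI DERIV_isCont) force
    qed
    with max[of h] h show False by simp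
  qed
qed

text \<open>Every coordinate line through the maximum point reduces the claim to one variable.\<close>

lemma grad_laplacian_at_max:
  fixes f :: "'a::euclidean_space \<Rightarrow> real"
  assumes "open S" "Ck_on 2 S f" "x \<in> S" and max: "\<And>y. y \<in> S \<Longrightarrow> f y \<le> f x"
  shows "grad f x = 0" "laplacian f x \<le> 0"
proof -
  obtain d where d: "d > 0" "ball x d \<subseteq> S"
    using assms(1,3) openE by blast
  define D where "D i = frechet_derivative (\<lambda>y. frechet_derivative f (at y) i) (at x)" for i
  have *: "grad f x \<bullet> i = 0 \<and> D i i \<le> 0" if i: "i \<in> Basis" for i
  proof -
    have inS: "x + t *\<^sub>R i \<in> S" if "\<bar>t\<bar> < d" for t
      using d(2) that i by (auto simp: dist_norm subset_iff)
    have line: "((\<lambda>t. x + t *\<^sub>R i) has_derivative (\<lambda>h. h *\<^sub>R i)) (at t)" for t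
      by (auto intro!: derivative_eq_intros)
    have 1: "((\<lambda>t. f (x + t *\<^sub>R i)) has_real_derivative grad f (x + t *\<^sub>R i) \<bullet> i) (at t)"
      if "\<bar>t\<bar> < d" for t
    proof -
      have "f differentiable (at (x + t *\<^sub>R i))"
        using assms(2) inS[OF that] by (auto simp: numeral_2_eq_2)
      from has_derivative_compose[OF line has_derivative_grad[OF this]]
      show ?thesis by (rule has_derivative_imp_has_field_derivative) simp
    qed
    have 2: "((\<lambda>t. grad f (x + t *\<^sub>R i) \<bullet> i) has_real_derivative D i i) (at 0)"
    proof -
      have Di: "((\<lambda>y. grad f y \<bullet> i) has_derivative D i) (at (x + 0 *\<^sub>R i))"
        using grad_inner_has_derivative[OF assms(1-3), of i] by (simp add: D_def)
      have "D i (h *\<^sub>R i) = D i i * h" for h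
        using linear_scale[OF has_derivative_linear[OF Di]] by (simp add: mult.commute)
      with has_derivative_compose[OF line Di]
      show ?thesis by (simp add: has_field_derivative_def)
    qed
    show ?thesis
      using second_derivative_nonpos_at_local_max[OF d(1) 1 2] max inS by simp
  qed
  then show "grad f x = 0"
    by (simp add: euclidean_eq_iff[of "grad f x"])
  show "laplacian f x \<le> 0"
    using * by (auto simp: laplacian_def D_def intro: sum_nonpos)
qed

text \<open>The barrier \<open>E x = exp (\<gamma> x\<^sub>i)\<close> with \<open>\<gamma> > sup |b|\<close> satisfies
  \<open>\<Delta>E + b \<cdot> \<nabla>E = \<gamma> E (\<gamma> + b\<^sub>i) > 0\<close>. Adding \<open>\<epsilon> E\<close> makes the differential inequality for \<open>h\<close> strict, so that
  \<open>h + \<epsilon> E\<close> has no interior maximum and is bounded by its boundary values; then \<open>\<epsilon> \<rightarrow> 0\<close>.\<close>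

lemma weak_maximum_principle:
  fixes h :: "'a::euclidean_space \<Rightarrow> real"
  assumes Ck: "Ck_on 2 (ball 0 R) h" and cont: "continuous_on (cball 0 R) h"
    and M: "\<And>x. x \<in> ball 0 R \<Longrightarrow> norm (b x) \<le> M"
    and L: "\<And>x. x \<in> ball 0 R \<Longrightarrow> laplacian h x + b x \<bullet> grad h x \<ge> 0"
    and bdry: "\<And>x. x \<in> sphere 0 R \<Longrightarrow> h x \<le> 0"
    and x: "x \<in> cball 0 R"
  shows "h x \<le> 0"
proof (rule field_le_epsilon)
  fix \<delta> :: real assume "\<delta> > 0"
  obtain i0 :: 'a where i0: "i0 \<in> Basis"
    using nonempty_Basis by blast
  define \<gamma> where "\<gamma> = \<bar>M\<bar> + 1"
  define E where "E y = exp (\<gamma> * (y \<bullet> i0))" for y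
  define K where "K = exp (\<gamma> * R)"
  have E_pos: "E y > 0" for y by (simp add: E_def)
  have E_le: "E y \<le> K" if "y \<in> cball 0 R" for y
    using that Cauchy_Schwarz_ineq2[of y i0] i0 by (auto simp: E_def K_def \<gamma>_def intro!: mult_left_mono)
  have E_Ck: "Ck_on 2 (ball 0 R) E"
    unfolding E_def by (intro Ck_on_exp Ck_on_mult Ck_on_const Ck_on_inner_left) auto
  have E_deriv: "(E has_derivative (\<lambda>v. ((\<gamma> * E y) *\<^sub>R i0) \<bullet> v)) (at y)" for y
    unfolding E_def by (auto intro!: derivative_eq_intros simp: inner_commute)
  have E_deriv2: "((\<lambda>y. ((\<gamma> * E y) *\<^sub>R i0) \<bullet> i) has_derivative
      (\<lambda>v. \<gamma> * (((\<gamma> * E y) *\<^sub>R i0) \<bullet> v) * (i0 \<bullet> i))) (at y)" for y i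
    by (auto intro!: derivative_eq_intros E_deriv)
  note GL = grad_laplacian_eqI[OF open_UNIV UNIV_I E_deriv E_deriv2]
  have E_L: "laplacian E y + b y \<bullet> grad E y > 0" if "y \<in> ball 0 R" for y
  proof -
    have "(\<Sum>i\<in>Basis. \<gamma> * (((\<gamma> * E y) *\<^sub>R i0) \<bullet> i) * (i0 \<bullet> i)) = \<gamma> * (\<gamma> * E y)"
      using i0 by (simp add: inner_Basis if_distrib if_distribR sum.delta cong: if_cong)
    then have "laplacian E y + b y \<bullet> grad E y = \<gamma> * E y * (\<gamma> + b y \<bullet> i0)"
      using GL by (simp add: algebra_simps)
    moreover have "\<gamma> + b y \<bullet> i0 > 0"
      using Cauchy_Schwarz_ineq2[of "b y" i0] M[OF that] i0 by (simp add: \<gamma>_def)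
    moreover have "\<gamma> > 0" by (simp add: \<gamma>_def)
    ultimately show ?thesis using E_pos by simp
  qed
  define \<epsilon> where "\<epsilon> = \<delta> / K"
  have \<epsilon>: "\<epsilon> > 0" using \<open>\<delta> > 0\<close> by (simp add: \<epsilon>_def K_def)
  define k where "k y = h y + \<epsilon> * E y" for y
  have "continuous_on (cball 0 R) k"
    unfolding k_def E_def by (intro continuous_intros cont)
  then obtain z where z: "z \<in> cball 0 R" and z_max: "\<And>y. y \<in> cball 0 R \<Longrightarrow> k y \<le> k z"
    using continuous_attains_sup[OF compact_cball] x by blast
  have "z \<notin> ball 0 R"
  proof
    assume zb: "z \<in> ball 0 R"
    have kCk: "Ck_on 2 (ball 0 R) k"
      unfolding k_def by (intro Ck_on_add Ck_on_mult Ck_on_const Ck E_Ck) auto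
    have "grad k z = 0" "laplacian k z \<le> 0"
      using grad_laplacian_at_max[OF open_ball kCk zb] z_max by auto
    moreover have "laplacian k z + b z \<bullet> grad k z
        = (laplacian h z + b z \<bullet> grad h z) + \<epsilon> * (laplacian E z + b z \<bullet> grad E z)"
      unfolding k_def[abs_def] grad_laplacian_add_cmult[OF open_ball Ck E_Ck zb]
      by (simp add: inner_add_right algebra_simps)
    ultimately show False
      using L[OF zb] mult_pos_pos[OF \<epsilon> E_L[OF zb]] by simp
  qed
  then have "z \<in> sphere 0 R" using z by auto
  have "h x \<le> k x" using mult_pos_pos[OF \<epsilon> E_pos[of x]] by (simp add: k_def)
  also have "\<dots> \<le> k z" using z_max x by blast
  also have "\<dots> \<le> \<epsilon> * K"
    using bdry[OF \<open>z \<in> sphere 0 R\<close>] mult_left_mono[OF E_le[OF z] less_imp_le[OF \<epsilon>]]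
    unfolding k_def by linarith
  finally show "h x \<le> 0 + \<delta>" by (simp add: \<epsilon>_def K_def)
qed

text \<open>The maximum principle applies to the difference of two solutions, in both orders.\<close>

lemma classical_solution_unique:
  fixes b :: "'a::euclidean_space \<Rightarrow> 'a"
  assumes b: "\<And>x. x \<in> ball 0 R \<Longrightarrow> norm (b x) \<le> M"
    and u: "classical_solution R b f u"
  shows "unique_classical_solution R b f u"
proof -
  have le: "v x \<le> w x"
    if v: "classical_solution R b f v" and w: "classical_solution R b f w" and x: "x \<in> cball 0 R"
    for v w x
  proof -
    define h where "h y = v y + (-1) * w y" for y
    have Ck: "Ck_on 2 (ball 0 R) v" "Ck_on 2 (ball 0 R) w"
      using v w by (auto simp: classical_solution_def)
    have "h x \<le> 0"
    proof (rule weak_maximum_principle[OF _ _ b _ _ x])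
      show "Ck_on 2 (ball 0 R) h"
        unfolding h_def by (intro Ck_on_add Ck_on_mult Ck_on_const Ck open_ball)
      show "continuous_on (cball 0 R) h"
        unfolding h_def using v w by (intro continuous_intros) (auto simp: classical_solution_def)
      show "0 \<le> laplacian h y + b y \<bullet> grad h y" if "y \<in> ball 0 R" for y
      proof -
        have "laplacian v y + b y \<bullet> grad v y = f y" "laplacian w y + b y \<bullet> grad w y = f y"
          using v w that by (auto simp: classical_solution_def)
        then show ?thesis
          unfolding h_def[abs_def] grad_laplacian_add_cmult[OF open_ball Ck that]
          by (simp add: inner_add_right inner_diff_right)
      qed
      show "h y \<le> 0" if "y \<in> sphere 0 R" for y
        using v w that by (auto simp: classical_solution_def h_def)
    qed auto
    then show ?thesis by (simp add: h_def)
  qed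
  show ?thesis
    unfolding unique_classical_solution_def using u le[OF _ u] le[OF u] by (simp add: antisym)
qed

section \<open>A smooth drift and a smooth compactly supported source\<close>

text \<open>A common denominator: it is positive on the whole line, and equals \<open>s \<cdot> flat 0 s\<close> for \<open>s \<ge> 1\<close>.\<close>

definition blend :: "real \<Rightarrow> real" where
  "blend s = s * flat 0 s + flat 0 (1 - s)"

text \<open>A smooth function on the line that coincides with \<open>1/s\<close> for \<open>s \<ge> 1\<close>.\<close>

definition reg_inverse :: "real \<Rightarrow> real" where
  "reg_inverse s = flat 0 s * inverse (blend s)"

text \<open>The defect \<open>1 - s \<cdot> reg_inverse s\<close>, written so that its sign and its support are visible.\<close>

definition bump :: "real \<Rightarrow> real" where
  "bump s = flat 0 (1 - s) * inverse (blend s)"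

lemma flat_nonneg: "flat m t \<ge> 0" and flat_pos: "t > 0 \<Longrightarrow> flat m t > 0"
  and flat_nonpos: "t \<le> 0 \<Longrightarrow> flat m t = 0"
  by (auto simp: flat_def)

lemma blend_pos: "blend s > 0"
proof (cases "s > 0")
  case True
  then show ?thesis
    using mult_pos_pos[OF True flat_pos[OF True, of 0]] flat_nonneg[of 0 "1 - s"]
    by (simp add: blend_def)
next
  case False
  then show ?thesis
    using flat_pos[of "1 - s" 0] flat_nonpos[of s 0] by (simp add: blend_def)
qed

lemma bump_nonneg: "bump s \<ge> 0" and bump_pos: "s < 1 \<Longrightarrow> bump s > 0"
  and bump_eq_0: "s \<ge> 1 \<Longrightarrow> bump s = 0" and reg_inverse_nonneg: "reg_inverse s \<ge> 0"
  using blend_pos[of s] by (auto simp: bump_def reg_inverse_def flat_nonneg flat_pos flat_nonpos)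

lemma reg_inverse_bump: "s * reg_inverse s = 1 - bump s"
proof -
  have "s * reg_inverse s + bump s = blend s * inverse (blend s)"
    by (simp add: reg_inverse_def bump_def blend_def algebra_simps)
  then show ?thesis using blend_pos[of s] by simp
qed

lemma bump_le_1: "s \<ge> 0 \<Longrightarrow> bump s \<le> 1"
  using reg_inverse_bump[of s] mult_nonneg_nonneg[of s "reg_inverse s"] reg_inverse_nonneg[of s]
  by linarith

text \<open>For \<open>s \<ge> 1/2\<close> the bound comes from \<open>s \<cdot> reg_inverse s \<le> 1\<close>; for \<open>s < 1/2\<close> the second summand of
  \<^term>\<open>blend s\<close> already dominates the numerator.\<close>

lemma reg_inverse_le_2:
  assumes "s \<ge> 0"
  shows "reg_inverse s \<le> 2"
proof (cases "s \<ge> 1/2")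
  case True
  have "1/2 * reg_inverse s \<le> s * reg_inverse s"
    by (intro mult_right_mono True reg_inverse_nonneg)
  then show ?thesis
    using reg_inverse_bump[of s] bump_nonneg[of s] by linarith
next
  case False
  have "flat 0 s \<le> flat 0 (1 - s)"
  proof (cases "s = 0")
    case False
    then have "1 / (1 - s) \<le> 1 / s"
      using assms \<open>\<not> s \<ge> 1/2\<close> by (intro divide_left_mono) auto
    then show ?thesis
      using False assms \<open>\<not> s \<ge> 1/2\<close> by (simp add: flat_def)
  qed (simp add: flat_def)
  then have "flat 0 s \<le> blend s"
    using assms mult_nonneg_nonneg[OF assms flat_nonneg[of 0 s]] by (simp add: blend_def)
  then have "flat 0 s * inverse (blend s) \<le> blend s * inverse (blend s)"
    using blend_pos[of s] by (intro mult_right_mono) auto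
  then show ?thesis
    using blend_pos[of s] by (simp add: reg_inverse_def)
qed

lemma norm_mult_reg_inverse_le:
  fixes x :: "'a::euclidean_space"
  shows "norm x * reg_inverse (x \<bullet> x) \<le> 2"
proof (cases "norm x \<le> 1")
  case True
  then show ?thesis
    using mult_mono[OF True reg_inverse_le_2[of "x \<bullet> x"]] reg_inverse_nonneg by simp
next
  case False
  have "norm x * reg_inverse (x \<bullet> x) \<le> norm x * (norm x * reg_inverse (x \<bullet> x))"
    using False reg_inverse_nonneg[of "x \<bullet> x"]
    by (intro mult_left_mono) (auto simp: mult_le_cancel_right1)
  also have "\<dots> = (x \<bullet> x) * reg_inverse (x \<bullet> x)"
    by (simp add: dot_square_norm power2_eq_square)
  finally show ?thesis
    using bump_nonneg[of "x \<bullet> x"] unfolding reg_inverse_bump by linarith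
qed

definition japanese_bracket :: "'a::euclidean_space \<Rightarrow> real" where
  "japanese_bracket x = sqrt (1 + x \<bullet> x)"

text \<open>With \<open>s = x \<bullet> x\<close> and \<open>p = \<langle>x\<rangle>\<close>, the function \<open>w = - exp p\<close> has the gradient \<open>- (exp p / p) x\<close> and the Laplacian
  \<open>- (exp p / p) (n + s (1/p - 1/p\<^sup>2))\<close>. A drift \<open>- \<beta> x\<close> adds \<open>(exp p / p) \<beta> s\<close>. The choice
  \<open>\<beta> = n/s + 1/p - 1/p\<^sup>2\<close> would give the equation with zero right-hand side; replacing the singular
  \<open>1/s\<close> by its regularization leaves the source \<open>- n (exp p / p) (1 - s \<cdot> reg_inverse s)\<close>.\<close>

definition drift :: "'a::euclidean_space \<Rightarrow> 'a" where
  "drift x = - ((real DIM('a) * reg_inverse (x \<bullet> x)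
      + inverse (japanese_bracket x) * (1 - inverse (japanese_bracket x))) *\<^sub>R x)"

text \<open>The normalization is dictated by \<open>R = 1\<close>: it turns \<open>exp P - exp 1 \<ge> (1 - exp (1 - sqrt 2)) exp P\<close>, valid
  for \<open>P \<ge> sqrt 2\<close>, into the lower bound \<open>2 exp P\<close>.\<close>

definition amplitude :: real where
  "amplitude = 2 / (1 - exp (1 - sqrt 2))"

text \<open>The common gradient of all functions \<open>solution R\<close> below, which differ from one another by constants.\<close>

definition gradient_field :: "'a::euclidean_space \<Rightarrow> 'a" where
  "gradient_field x = - ((amplitude * exp (japanese_bracket x) * inverse (japanese_bracket x)) *\<^sub>R x)"

definition source :: "'a::euclidean_space \<Rightarrow> real" where
  "source x = - (amplitude * real DIM('a) * exp (japanese_bracket x)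
      * inverse (japanese_bracket x) * bump (x \<bullet> x))"

definition solution :: "real \<Rightarrow> 'a::euclidean_space \<Rightarrow> real" where
  "solution R x = amplitude * (exp (sqrt (1 + R\<^sup>2)) - exp (japanese_bracket x))"

lemma one_minus_exp: "0 < 1 - exp (1 - sqrt 2)" "1 - exp (1 - sqrt 2) < 1"
  by auto

lemma amplitude_ge_2: "amplitude \<ge> 2"
  using one_minus_exp by (simp add: amplitude_def le_divide_eq)

lemma japanese_bracket_ge_1: "japanese_bracket x \<ge> 1"
  by (simp add: japanese_bracket_def)

lemma japanese_bracket_pos: "japanese_bracket x > 0"
  using japanese_bracket_ge_1[of x] by linarith

lemma japanese_bracket_square: "japanese_bracket x * japanese_bracket x = 1 + x \<bullet> x"
  by (simp add: japanese_bracket_def)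

lemma norm_le_japanese_bracket: "norm x \<le> japanese_bracket x"
  by (simp add: japanese_bracket_def norm_eq_sqrt_inner)

lemma japanese_bracket_has_derivative:
  "(japanese_bracket has_derivative (\<lambda>v. inverse (japanese_bracket x) * (x \<bullet> v))) (at x)"
proof -
  have "1 + x \<bullet> x > 0" by (simp add: add_pos_nonneg)
  then show ?thesis
    unfolding japanese_bracket_def[abs_def]
    by (auto intro!: derivative_eq_intros simp: inner_commute field_simps)
qed

lemma Ck_on_japanese_bracket: "Ck_on k UNIV japanese_bracket"
  unfolding japanese_bracket_def[abs_def]
  by (intro Ck_on_sqrt Ck_on_add Ck_on_const Ck_on_inner_self open_UNIV) (simp add: add_pos_nonneg)

lemma Ck_on_inverse_japanese_bracket: "Ck_on k UNIV (\<lambda>x. inverse (japanese_bracket x))"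
  using japanese_bracket_pos less_imp_neq
  by (intro Ck_on_inverse Ck_on_japanese_bracket open_UNIV) fastforce

lemma Ck_on_inverse_blend:
  "Ck_on k UNIV (\<lambda>x::'a::euclidean_space. inverse (blend (x \<bullet> x)))"
proof (rule Ck_on_inverse[OF open_UNIV])
  show "Ck_on k UNIV (\<lambda>x::'a. blend (x \<bullet> x))"
    unfolding blend_def
    by (intro Ck_on_add Ck_on_mult Ck_on_flat Ck_on_diff Ck_on_const Ck_on_inner_self open_UNIV)
  show "blend (x \<bullet> x) \<noteq> 0" for x :: 'a
    using blend_pos[of "x \<bullet> x"] by simp
qed

lemma smooth_drift: "smooth_on UNIV drift"
  unfolding smooth_on_def drift_def[abs_def] reg_inverse_def
  by (intro allI Ck_on_minus Ck_on_scaleR Ck_on_add Ck_on_mult Ck_on_diff Ck_on_flat Ck_on_const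
      Ck_on_inner_self Ck_on_inverse_blend Ck_on_inverse_japanese_bracket
      Ck_on_bounded_linear[OF _ bounded_linear_ident] open_UNIV)

lemma smooth_source: "smooth_on UNIV source"
  unfolding smooth_on_def source_def[abs_def] bump_def
  by (intro allI Ck_on_minus Ck_on_mult Ck_on_diff Ck_on_flat Ck_on_const Ck_on_exp
      Ck_on_inner_self Ck_on_inverse_blend Ck_on_inverse_japanese_bracket Ck_on_japanese_bracket
      open_UNIV)

lemma Ck_on_solution: "Ck_on k UNIV (solution R)"
  unfolding solution_def[abs_def]
  by (intro Ck_on_mult Ck_on_diff Ck_on_const Ck_on_exp Ck_on_japanese_bracket open_UNIV)

lemma continuous_on_gradient_field: "continuous_on S gradient_field"
proof -
  have "Ck_on 0 UNIV (gradient_field :: 'a \<Rightarrow> 'a)"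
    unfolding gradient_field_def[abs_def]
    by (intro Ck_on_minus Ck_on_scaleR Ck_on_mult Ck_on_const Ck_on_exp Ck_on_japanese_bracket
        Ck_on_inverse_japanese_bracket Ck_on_bounded_linear[OF _ bounded_linear_ident] open_UNIV)
  then show ?thesis
    by (auto intro: continuous_on_subset)
qed

text \<open>The radial part \<open>1/p - 1/p\<^sup>2\<close> is at most \<open>1/p \<le> 1/|x|\<close>, and the regularized part is at most
  \<open>2n/|x|\<close>.\<close>

lemma norm_drift_le: "norm (drift (x::'a::euclidean_space)) \<le> 2 * real DIM('a) + 1"
proof -
  define p where "p = japanese_bracket x"
  have p: "p \<ge> 1" "norm x \<le> p"
    unfolding p_def by (rule japanese_bracket_ge_1, rule norm_le_japanese_bracket)
  have "norm x * (inverse p * (1 - inverse p)) \<le> p * (inverse p * 1)"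
    using p by (intro mult_mono) (auto simp: inverse_le_1_iff)
  then have 1: "norm x * (inverse p * (1 - inverse p)) \<le> 1"
    using p by simp
  have 2: "real DIM('a) * (norm x * reg_inverse (x \<bullet> x)) \<le> real DIM('a) * 2"
    by (intro mult_left_mono norm_mult_reg_inverse_le) simp
  have "real DIM('a) * reg_inverse (x \<bullet> x) + inverse p * (1 - inverse p) \<ge> 0"
    using p reg_inverse_nonneg[of "x \<bullet> x"] by (auto simp: inverse_le_1_iff)
  then have "norm (drift x) = (real DIM('a) * reg_inverse (x \<bullet> x)
      + inverse p * (1 - inverse p)) * norm x"
    by (simp add: drift_def p_def)
  also have "\<dots> = real DIM('a) * (norm x * reg_inverse (x \<bullet> x)) + norm x * (inverse p * (1 - inverse p))"
    by (simp only: algebra_simps)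
  finally show ?thesis using 1 2 by linarith
qed

text \<open>A pointwise lower bound on a fixed annulus inside the unit ball suffices to bound the essential
  supremum over every ball of radius at least \<open>1\<close> from below; there \<open>11/10 < \<langle>x\<rangle>\<close> and \<open>\<langle>x\<rangle>\<^sup>2 < 2\<close>.\<close>

lemma norm_drift_gt:
  fixes x :: "'a::euclidean_space"
  assumes "1/2 < norm x" "norm x < 1"
  shows "norm (drift x) > 1/40"
proof -
  define p where "p = japanese_bracket x"
  have p1: "p \<ge> 1"
    unfolding p_def by (rule japanese_bracket_ge_1)
  have pp: "p * p = 1 + (norm x)\<^sup>2"
    by (simp add: p_def japanese_bracket_square dot_square_norm)
  have "(norm x)\<^sup>2 > (1/2)\<^sup>2" "(norm x)\<^sup>2 < 1\<^sup>2"
    using assms by (intro power_strict_mono; simp)+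
  then have pp': "p * p > 5/4" "p * p < 2"
    unfolding pp by (auto simp: power2_eq_square)
  have p_gt: "p > 11/10"
  proof (rule ccontr)
    assume "\<not> p > 11/10"
    then have "p * p \<le> 11/10 * (11/10)"
      using p1 by (intro mult_mono) auto
    with pp' show False by simp
  qed
  have "inverse p * (1 - inverse p) = (p - 1) / (p * p)"
    using p1 by (simp add: field_simps)
  also have "\<dots> > (1/10) / 2"
    using p_gt pp' by (intro frac_less) auto
  finally have "(1/10) / 2 < inverse p * (1 - inverse p)" .
  then have "(1/2) * ((1/10) / 2) < norm x * (inverse p * (1 - inverse p))"
    using assms by (intro mult_strict_mono) auto
  also have "\<dots> \<le> (real DIM('a) * reg_inverse (x \<bullet> x) + inverse p * (1 - inverse p)) * norm x"
    using mult_nonneg_nonneg[of "norm x" "real DIM('a) * reg_inverse (x \<bullet> x)"] reg_inverse_nonneg[of "x \<bullet> x"]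
    by (simp add: algebra_simps)
  also have "\<dots> \<le> norm (drift x)"
    by (simp add: drift_def p_def mult_right_mono)
  finally show ?thesis by simp
qed

lemma source_eq_0: "norm x \<ge> 1 \<Longrightarrow> source x = 0"
  by (simp add: source_def bump_eq_0 dot_square_norm)

lemma source_neq_0: "norm x < 1 \<Longrightarrow> source x \<noteq> 0"
  using bump_pos[of "x \<bullet> x"] amplitude_ge_2 japanese_bracket_pos[of x]
  by (auto simp: source_def dot_square_norm power_less_one_iff)

lemma abs_source_le:
  fixes x :: "'a::euclidean_space"
  shows "\<bar>source x\<bar> \<le> amplitude * real DIM('a) * exp (sqrt 2)"
proof (cases "norm x \<ge> 1")
  case True
  then show ?thesis using amplitude_ge_2 by (simp add: source_eq_0)
next
  case False
  then have s: "x \<bullet> x \<le> 1"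
    by (simp add: dot_square_norm power_le_one)
  define p where "p = japanese_bracket x"
  have p: "p \<ge> 1" "p \<le> sqrt 2"
    using japanese_bracket_ge_1[of x] s by (auto simp: p_def japanese_bracket_def)
  have "\<bar>source x\<bar> = amplitude * real DIM('a) * (exp p * inverse p * bump (x \<bullet> x))"
    using amplitude_ge_2 p bump_nonneg[of "x \<bullet> x"] by (simp add: source_def p_def abs_mult)
  also have "exp p * inverse p * bump (x \<bullet> x) \<le> exp (sqrt 2) * 1 * 1"
    using p bump_le_1[of "x \<bullet> x"] bump_nonneg[of "x \<bullet> x"]
    by (intro mult_mono) (auto simp: inverse_le_1_iff)
  finally show ?thesis
    using amplitude_ge_2 by (simp add: mult_left_mono)
qed

section \<open>The explicit solution and its exponential growth\<close>

lemma solution_has_derivative: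
  "(solution R has_derivative (\<lambda>v. gradient_field y \<bullet> v)) (at y)"
proof -
  note E = has_derivative_exp[OF japanese_bracket_has_derivative]
  have "(solution R has_derivative (\<lambda>v. amplitude *
      (0 - exp (japanese_bracket y) * (inverse (japanese_bracket y) * (y \<bullet> v))))) (at y)"
    unfolding solution_def[abs_def]
    by (rule has_derivative_eq_rhs[OF has_derivative_mult_right[OF
            has_derivative_diff[OF has_derivative_const E]]]) auto
  then show ?thesis
    by (simp add: gradient_field_def mult.assoc)
qed

text \<open>Here \<open>q = 1/\<langle>x\<rangle>\<close>, so that \<open>q (1 - q) = 1/\<langle>x\<rangle> - 1/\<langle>x\<rangle>\<^sup>2\<close> is the term cancelled by the drift.\<close>

lemma gradient_field_has_derivative:
  fixes x i :: "'a::euclidean_space"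
  defines "q \<equiv> inverse (japanese_bracket x)" and "w \<equiv> amplitude * exp (japanese_bracket x)"
  shows "((\<lambda>y. gradient_field y \<bullet> i) has_derivative
    (\<lambda>v. - (w * q * (v \<bullet> i) + w * q * (q * (1 - q)) * (x \<bullet> v) * (x \<bullet> i)))) (at x)"
proof -
  have nz: "japanese_bracket x \<noteq> 0"
    using japanese_bracket_pos[of x] by simp
  note E = has_derivative_exp[OF japanese_bracket_has_derivative, of x]
  note Q = Deriv.has_derivative_inverse[OF nz japanese_bracket_has_derivative]
  have I: "((\<lambda>y. y \<bullet> i) has_derivative (\<lambda>v. v \<bullet> i)) (at x)"
    by (rule bounded_linear_imp_has_derivative[OF bounded_linear_inner_left])
  show ?thesis
    unfolding gradient_field_def inner_minus_left inner_scaleR_left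
    by (rule has_derivative_eq_rhs[OF has_derivative_minus[OF has_derivative_mult[OF
            has_derivative_mult[OF has_derivative_mult_right[OF E] Q] I]]])
      (simp add: fun_eq_iff q_def w_def algebra_simps)
qed

text \<open>The two occurrences of \<open>q (1 - q) s\<close> cancel, and \<open>n - n s \<cdot> reg_inverse s\<close> remains.\<close>

lemma solution_pde:
  fixes x :: "'a::euclidean_space"
  shows "laplacian (solution R) x + drift x \<bullet> grad (solution R) x = source x"
proof -
  define p where "p = japanese_bracket x"
  define q where "q = inverse p"
  define w where "w = amplitude * exp p"
  note GL = grad_laplacian_eqI[OF open_UNIV UNIV_I solution_has_derivative
      gradient_field_has_derivative, of _ x, folded p_def, folded q_def w_def]
  have "laplacian (solution R) x
      = (\<Sum>i\<in>Basis. - (w * q * (i \<bullet> i) + w * q * (q * (1 - q)) * (x \<bullet> i) * (x \<bullet> i)))"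
    by (rule GL(2))
  also have "\<dots> = - (w * q * real DIM('a) + w * q * (q * (1 - q)) * (\<Sum>i\<in>Basis. (x \<bullet> i) * (x \<bullet> i)))"
    by (simp only: sum_negf sum.distrib sum_distrib_left mult.assoc) (simp add: mult.commute)
  also have "(\<Sum>i\<in>Basis. (x \<bullet> i) * (x \<bullet> i)) = x \<bullet> x"
    by (rule euclidean_inner[symmetric])
  finally have "laplacian (solution R) x = - (w * q * real DIM('a) + w * q * (q * (1 - q)) * (x \<bullet> x))" .
  moreover have "drift x \<bullet> grad (solution R) x
      = w * q * (q * (1 - q)) * (x \<bullet> x) + w * q * real DIM('a) * ((x \<bullet> x) * reg_inverse (x \<bullet> x))"
    unfolding GL(1) by (simp add: drift_def gradient_field_def p_def q_def w_def algebra_simps)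
  ultimately show ?thesis
    unfolding reg_inverse_bump
    by (simp add: source_def p_def q_def w_def algebra_simps)
qed

lemma classical_solution_solution:
  assumes "R > 0"
  shows "classical_solution R drift source (solution R)"
  unfolding classical_solution_def
proof (intro conjI ballI)
  show "Ck_on 2 (ball 0 R) (solution R)"
    by (rule Ck_on_subset[OF Ck_on_solution]) simp
  have "Ck_on 0 (cball 0 R) (solution R)"
    by (rule Ck_on_subset[OF Ck_on_solution]) simp
  then show "continuous_on (cball 0 R) (solution R)" by simp
  show "solution R x = 0" if "x \<in> sphere 0 R" for x :: 'a
    using that by (simp add: solution_def japanese_bracket_def dot_square_norm)
qed (rule solution_pde)

lemma solution_pos: "x \<in> ball 0 R \<Longrightarrow> solution R x > 0"
  using amplitude_ge_2
  by (auto simp: solution_def japanese_bracket_def dot_square_norm intro!: mult_pos_pos power_strict_mono)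

text \<open>With \<open>P = sqrt (1 + R\<^sup>2)\<close> the value at the centre is at least \<open>2 exp P \<ge> 2 exp R\<close>, and division by
  \<open>R \<le> 2 exp (R/2)\<close> costs half of the exponent.\<close>

lemma solution_0_div_ge:
  assumes "R \<ge> 1"
  shows "solution R (0::'a::euclidean_space) / R \<ge> exp (R / 2)"
proof -
  define P where "P = sqrt (1 + R\<^sup>2)"
  have P: "P \<ge> sqrt 2" "P \<ge> R"
    using assms by (auto simp: P_def intro: real_le_rsqrt)
  have "2 * exp P = amplitude * (exp P * (1 - exp (1 - sqrt 2)))"
    using one_minus_exp by (simp add: amplitude_def)
  also have "\<dots> \<le> amplitude * (exp P * (1 - exp (1 - P)))"
    using P amplitude_ge_2 by (intro mult_left_mono) auto
  also have "\<dots> = solution R (0::'a)"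
    by (simp add: solution_def japanese_bracket_def P_def right_diff_distrib exp_diff)
  finally have "2 * exp R \<le> solution R (0::'a)"
    using P(2) by (smt (verit) exp_le_cancel_iff)
  moreover have "R * exp (R / 2) \<le> 2 * exp R"
  proof -
    have "R \<le> 2 * exp (R / 2)"
      using exp_ge_add_one_self[of "R / 2"] by linarith
    then have "R * exp (R / 2) \<le> (2 * exp (R / 2)) * exp (R / 2)"
      by (intro mult_right_mono) auto
    then show ?thesis
      by (simp add: exp_add[symmetric] mult.assoc)
  qed
  ultimately show ?thesis
    using assms by (simp add: le_divide_eq mult.commute)
qed

lemma norm_gradient_field_ge:
  fixes x :: "'a::euclidean_space"
  assumes "R \<ge> 1" "norm x = R"
  shows "norm (gradient_field x) \<ge> exp (R / 2)"
proof -
  define P where "P = sqrt (1 + R\<^sup>2)"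
  have "1 + R\<^sup>2 \<le> (2 * R)\<^sup>2"
    using one_le_power[OF assms(1), of 2] by (simp add: power_mult_distrib)
  then have P: "P \<ge> R" "P \<le> 2 * R" "P > 0"
    using assms by (auto simp: P_def intro: real_le_rsqrt real_le_lsqrt add_pos_nonneg)
  have "exp (R / 2) \<le> exp P"
    using P assms by simp
  also have "\<dots> = 2 * exp P * (1 / 2)" by simp
  also have "\<dots> \<le> amplitude * exp P * (R / P)"
    using P amplitude_ge_2 assms by (intro mult_mono) (auto simp: divide_simps)
  also have "\<dots> = norm (gradient_field x)"
    using amplitude_ge_2 P assms
    by (simp add: gradient_field_def japanese_bracket_def dot_square_norm P_def abs_mult divide_inverse)
  finally show ?thesis .
qed

lemma bdry_dist_0:
  assumes "R > 0"
  shows "bdry_dist R (0::'a::euclidean_space) = R"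
proof -
  obtain i :: 'a where "i \<in> Basis" using nonempty_Basis by blast
  then have "R *\<^sub>R i \<in> sphere 0 R" using assms by simp
  then have "sphere (0::'a) R \<noteq> {}" by blast
  then have "infdist (0::'a) (sphere 0 R) = R"
    by (simp add: infdist_def image_constant_conv cong: image_cong_simp)
  then show ?thesis
    using assms by (simp add: bdry_dist_def frontier_ball)
qed

section \<open>Norms of the drift, the source and the boundary gradient\<close>

lemma borel_imp_lebesgue_on_measurable:
  "g \<in> borel_measurable borel \<Longrightarrow> g \<in> borel_measurable (lebesgue_on S)"
  by (intro measurable_restrict_space1 measurable_completion) simp

text \<open>A nonempty open set is not negligible, so values taken on it are seen by the essential supremum.\<close>

lemma esssup_lebesgue_on_gt:
  fixes h :: "'a::euclidean_space \<Rightarrow> ennreal"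
  assumes S: "S \<in> sets lebesgue" and U: "open U" "U \<noteq> {}" "U \<subseteq> S"
    and gt: "\<And>x. x \<in> U \<Longrightarrow> h x > c"
  shows "esssup (lebesgue_on S) h > c"
proof (rule ccontr)
  assume "\<not> ?thesis"
  then have "AE x in lebesgue_on S. h x \<le> c"
    using esssup_AE[where M = "lebesgue_on S" and f = h] by (auto elim!: eventually_mono)
  then have "AE x in lebesgue. x \<in> S \<longrightarrow> h x \<le> c"
    using S by (simp add: AE_restrict_space_iff)
  then have "AE x in lebesgue. x \<notin> U"
    by eventually_elim (use U gt in \<open>force simp: not_le[symmetric]\<close>)
  then have "negligible U"
    using U(1) by (simp add: negligible_iff_null_sets AE_iff_null_sets)
  then show False
    using open_not_negligible U by blast
qed

lemma smooth_bounded_imp_L_infinity: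
  fixes g :: "'a::euclidean_space \<Rightarrow> 'b::euclidean_space"
  assumes "smooth_on UNIV g" "\<And>x. norm (g x) \<le> K"
  shows "g \<in> borel_measurable borel" "L_infinity g"
proof -
  have "Ck_on 0 UNIV g"
    using assms(1) unfolding smooth_on_def by blast
  then show g: "g \<in> borel_measurable borel"
    by (simp add: borel_measurable_continuous_onI)
  then have m: "g \<in> borel_measurable lebesgue"
    by (intro measurable_completion) simp
  have "esssup lebesgue (\<lambda>x. ennreal (norm (g x))) \<le> ennreal K"
    using m assms(2) by (intro esssup_I AE_I2) (auto intro: ennreal_leI)
  then show "L_infinity g"
    using m by (auto simp: L_infinity_def Lq_norm_def intro: le_less_trans)
qed

lemma Lq_norm_drift:
  assumes "R \<ge> 1"
  shows "ennreal (1/40) \<le> Lq_norm (lebesgue_on (ball 0 R)) \<infinity> (drift :: 'a::euclidean_space \<Rightarrow> 'a)"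
    "Lq_norm (lebesgue_on (ball 0 R)) \<infinity> (drift :: 'a \<Rightarrow> 'a) \<le> ennreal (2 * real DIM('a) + 1)"
proof -
  obtain i :: 'a where i: "i \<in> Basis" using nonempty_Basis by blast
  define U where "U = {x::'a. 1/2 < norm x \<and> norm x < 1}"
  have "open U"
    unfolding U_def by (intro open_Collect_conj open_Collect_less continuous_intros)
  moreover have "(3/4) *\<^sub>R i \<in> U"
    using i by (simp add: U_def)
  moreover have "U \<subseteq> ball 0 R"
    using assms by (auto simp: U_def)
  moreover have "ennreal (1/40) < ennreal (norm (drift x))" if "x \<in> U" for x
    using norm_drift_gt[of x] that unfolding U_def by (intro ennreal_lessI) auto
  ultimately have "esssup (lebesgue_on (ball 0 R)) (\<lambda>x. ennreal (norm (drift x :: 'a))) > ennreal (1/40)"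
    by (intro esssup_lebesgue_on_gt[of _ U]) auto
  then show "ennreal (1/40) \<le> Lq_norm (lebesgue_on (ball 0 R)) \<infinity> (drift :: 'a \<Rightarrow> 'a)"
    by (simp add: Lq_norm_def)
  have "(drift :: 'a \<Rightarrow> 'a) \<in> borel_measurable (lebesgue_on (ball 0 R))"
    by (intro borel_imp_lebesgue_on_measurable smooth_bounded_imp_L_infinity(1)[OF smooth_drift norm_drift_le])
  then have "esssup (lebesgue_on (ball 0 R)) (\<lambda>x. ennreal (norm (drift x :: 'a))) \<le> ennreal (2 * real DIM('a) + 1)"
    by (intro esssup_I AE_I2 ennreal_leI norm_drift_le) auto
  then show "Lq_norm (lebesgue_on (ball 0 R)) \<infinity> (drift :: 'a \<Rightarrow> 'a) \<le> ennreal (2 * real DIM('a) + 1)"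
    by (simp add: Lq_norm_def)
qed

text \<open>Both cases of the norm only see the unit ball, where the function is supported.\<close>

lemma Lq_norm_ball_const:
  fixes g :: "'a::euclidean_space \<Rightarrow> real"
  assumes g: "g \<in> borel_measurable borel" and R: "R \<ge> 1"
    and zero: "\<And>x. norm x \<ge> 1 \<Longrightarrow> g x = 0"
  shows "Lq_norm (lebesgue_on (ball 0 R)) q g = Lq_norm (lebesgue_on (ball 0 1)) q g"
proof -
  note m = borel_imp_lebesgue_on_measurable[OF g]
  have "(AE x in lebesgue_on (ball 0 R). ennreal (norm (g x)) \<le> z)
      \<longleftrightarrow> (AE x in lebesgue_on (ball 0 1). ennreal (norm (g x)) \<le> z)" for z
  proof -
    have "(x \<in> ball 0 R \<longrightarrow> ennreal (norm (g x)) \<le> z) \<longleftrightarrow> (x \<in> ball 0 1 \<longrightarrow> ennreal (norm (g x)) \<le> z)" for x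
      using R zero[of x] by (cases "norm x < 1") auto
    then show ?thesis by (simp add: AE_restrict_space_iff)
  qed
  moreover have "(\<lambda>x. ennreal (norm (g x))) \<in> borel_measurable (lebesgue_on S)" for S
    using m[of S] by simp
  ultimately have inf: "esssup (lebesgue_on (ball 0 R)) (\<lambda>x. ennreal (norm (g x)))
      = esssup (lebesgue_on (ball 0 1)) (\<lambda>x. ennreal (norm (g x)))"
    by (simp add: esssup_eq_AE)
  have "(\<integral>\<^sup>+ x. ennreal (norm (g x) powr r) \<partial>lebesgue_on (ball 0 R))
      = (\<integral>\<^sup>+ x. ennreal (norm (g x) powr r) \<partial>lebesgue_on (ball 0 1))" for r
  proof -
    have "ennreal (norm (g x) powr r) * indicator (ball 0 R) x
        = ennreal (norm (g x) powr r) * indicator (ball 0 1) x" for x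
      using R zero[of x] by (cases "norm x < 1") (auto simp: indicator_def)
    then show ?thesis by (simp add: nn_integral_restrict_space)
  qed
  then show ?thesis
    using inf m by (simp add: Lq_norm_def)
qed

lemma Lq_norm_ball_finite_pos:
  fixes g :: "'a::euclidean_space \<Rightarrow> real"
  assumes g: "g \<in> borel_measurable borel" and q: "q > 0" and K: "\<And>x. \<bar>g x\<bar> \<le> K"
    and nz: "\<And>x. norm x < 1 \<Longrightarrow> g x \<noteq> 0"
  shows "\<exists>C>0. Lq_norm (lebesgue_on (ball 0 1)) q g = ennreal C"
proof (cases "q = \<infinity>")
  case True
  have "esssup (lebesgue_on (ball 0 1)) (\<lambda>x. ennreal (norm (g x))) > 0"
    using nz by (intro esssup_lebesgue_on_gt[of _ "ball 0 1"]) auto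
  moreover have "esssup (lebesgue_on (ball 0 1)) (\<lambda>x. ennreal (norm (g x))) \<le> ennreal K"
    using borel_imp_lebesgue_on_measurable[OF g] K by (intro esssup_I AE_I2 ennreal_leI) auto
  ultimately show ?thesis
    using True by (cases "esssup (lebesgue_on (ball 0 1)) (\<lambda>x. ennreal (norm (g x)))")
      (auto simp: Lq_norm_def top_unique)
next
  case False
  define r where "r = enn2real q"
  have r: "r > 0"
    using q False by (simp add: r_def enn2real_positive_iff less_top)
  note m = borel_imp_lebesgue_on_measurable[OF g, of "ball 0 1"]
  define I where "I = (\<integral>\<^sup>+ x. ennreal (norm (g x) powr r) \<partial>lebesgue_on (ball 0 1))"
  have "I \<le> (\<integral>\<^sup>+ x. ennreal (K powr r) \<partial>lebesgue_on (ball (0::'a) 1))"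
    unfolding I_def using K r by (intro nn_integral_mono ennreal_leI powr_mono2) auto
  also have "\<dots> = ennreal (K powr r) * emeasure lebesgue (ball (0::'a) 1)"
    by (simp add: emeasure_restrict_space space_restrict_space)
  also have "\<dots> < \<infinity>"
    using emeasure_bounded_finite[of "ball (0::'a) 1"] by (auto simp: ennreal_mult_less_top)
  finally have I_fin: "I < \<infinity>" .
  have "I \<noteq> 0"
  proof
    assume "I = 0"
    then have "AE x in lebesgue_on (ball 0 1). ennreal (norm (g x) powr r) = 0"
      unfolding I_def using m by (subst (asm) nn_integral_0_iff_AE) auto
    then have "esssup (lebesgue_on (ball 0 1)) (\<lambda>x. ennreal (norm (g x) powr r)) \<le> 0"
      using m by (intro esssup_I) auto
    moreover have "esssup (lebesgue_on (ball 0 1)) (\<lambda>x. ennreal (norm (g x) powr r)) > 0"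
      using nz by (intro esssup_lebesgue_on_gt[of _ "ball 0 1"]) auto
    ultimately show False by simp
  qed
  then have "enn2real I powr (1 / r) > 0"
    using I_fin by (simp add: enn2real_eq_0_iff less_top)
  moreover have "Lq_norm (lebesgue_on (ball 0 1)) q g = ennreal (enn2real I powr (1 / r))"
    using False m I_fin by (simp add: Lq_norm_def I_def r_def Let_def)
  ultimately show ?thesis by blast
qed

text \<open>A constant is its own essential supremum for every nonzero measure, and the total mass of the surface
  measure is a positive multiple of the volume of the punctured ball.\<close>

lemma Lq_norm_sphere_const:
  fixes g :: "'a::euclidean_space \<Rightarrow> 'b::euclidean_space"
  assumes R: "R > 0" and g: "continuous_on UNIV g"
    and c: "\<And>x. x \<in> sphere 0 R \<Longrightarrow> norm (g x) = c"
  shows "Lq_norm (sphere_measure R) \<infinity> g = ennreal c"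
proof -
  define \<pi> where "\<pi> x = (R / norm x) *\<^sub>R x" for x :: 'a
  have "\<pi> \<in> borel_measurable borel"
    unfolding \<pi>_def by measurable
  then have pi: "\<pi> \<in> lebesgue_on (ball 0 R - {0}) \<rightarrow>\<^sub>M restrict_space borel (sphere 0 R)"
    using R by (intro measurable_restrict_space2 borel_imp_lebesgue_on_measurable)
      (auto simp: \<pi>_def space_restrict_space)
  define N where "N = distr (lebesgue_on (ball 0 R - {0})) (restrict_space borel (sphere 0 R)) \<pi>"
  have N: "sphere_measure R = scale_measure (ennreal (real DIM('a) / R)) N"
    by (simp add: sphere_measure_def N_def \<pi>_def[abs_def])
  have sets: "sets (sphere_measure R) = sets (restrict_space borel (sphere (0::'a) R))"
    by (simp add: N N_def)
  have sp: "space (sphere_measure R) = sphere (0::'a) R"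
    by (simp add: N N_def space_scale_measure space_restrict_space)
  have "open (ball (0::'a) R - {0})" by (simp add: open_Diff)
  moreover obtain i :: 'a where "i \<in> Basis" using nonempty_Basis by blast
  then have "(R / 2) *\<^sub>R i \<in> ball 0 R - {0}" using R by auto
  ultimately have "\<not> negligible (ball (0::'a) R - {0})"
    using open_not_negligible by (metis empty_iff)
  then have "emeasure lebesgue (ball (0::'a) R - {0}) \<noteq> 0"
    unfolding negligible_iff_null_sets by (auto intro: null_setsI simp del: emeasure_completion)
  moreover have "emeasure N (space N) = emeasure lebesgue (ball (0::'a) R - {0})"
  proof -
    have "\<pi> -` space N \<inter> space (lebesgue_on (ball 0 R - {0})) = space (lebesgue_on (ball 0 R - {0}))"
      using measurable_space[OF pi] by (auto simp: N_def)
    then have "emeasure N (space N) = emeasure (lebesgue_on (ball (0::'a) R - {0}))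
        (space (lebesgue_on (ball 0 R - {0})))"
      by (simp only: N_def emeasure_distr[OF pi sets.top] space_distr)
    then show ?thesis by (simp add: emeasure_restrict_space space_restrict_space)
  qed
  ultimately have "emeasure (sphere_measure R) (space (sphere_measure R :: 'a measure)) \<noteq> 0"
    using R by (simp add: N space_scale_measure ennreal_eq_0_iff not_le)
  then have "esssup (sphere_measure R :: 'a measure) (\<lambda>x. ennreal c) = ennreal c"
    by (rule esssup_const)
  moreover have "g \<in> borel_measurable borel"
    using g by (rule borel_measurable_continuous_onI)
  then have "g \<in> borel_measurable (restrict_space borel (sphere 0 R))"
    by (rule measurable_restrict_space1)
  then have "g \<in> borel_measurable (sphere_measure R)"
    using measurable_cong_sets[OF sets refl] by blast
  then have "esssup (sphere_measure R) (\<lambda>x. ennreal (norm (g x)))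
      = esssup (sphere_measure R :: 'a measure) (\<lambda>x. ennreal c)"
    by (intro esssup_AE_cong AE_I2) (auto simp: sp c)
  ultimately show ?thesis by (simp add: Lq_norm_def)
qed

text \<open>One half of the exponent \<open>R/2\<close> absorbs \<open>c0 M R \<le> R/4\<close>, the other half absorbs the polynomial factor
  through \<open>R \<le> 4 exp (R/4)\<close>; \<open>K\<close> is the norm of the source.\<close>

lemma exp_linear_growth_bound:
  fixes R M C K \<theta> c0 :: real
  assumes "R \<ge> 1" "C > 0" "K > 0" "0 \<le> M" "M \<le> C" "\<theta> \<ge> 0"
  defines "c0 \<equiv> min (1 / (4 * C)) (1 / (4 * K))"
  shows "c0 * exp (c0 * M * R) * R powr (1 - \<theta>) * K \<le> exp (1 / 2 * R)"
proof -
  have c0: "c0 > 0" "c0 \<le> 1 / (4 * C)" "c0 \<le> 1 / (4 * K)"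
    using assms by (auto simp: c0_def)
  have "c0 * M \<le> 1 / (4 * C) * C"
    using c0 assms by (intro mult_mono) auto
  then have "c0 * M * R \<le> 1 / 4 * R"
    using assms by (intro mult_right_mono) auto
  then have 1: "exp (c0 * M * R) \<le> exp (R / 4)" by simp
  have "R powr (1 - \<theta>) \<le> R powr 1"
    using assms by (intro powr_mono) auto
  also have "R powr 1 = R"
    using assms by simp
  also have "R \<le> 4 * exp (R / 4)"
    using exp_ge_add_one_self[of "R / 4"] by linarith
  finally have 2: "R powr (1 - \<theta>) \<le> 4 * exp (R / 4)" .
  have "c0 * K \<le> 1 / (4 * K) * K"
    using c0 assms by (intro mult_right_mono) auto
  then have 3: "c0 * K \<le> 1 / 4" using assms by simp
  have "c0 * exp (c0 * M * R) * R powr (1 - \<theta>) * K = (c0 * K) * (exp (c0 * M * R) * R powr (1 - \<theta>))"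
    by simp
  also have "\<dots> \<le> 1 / 4 * (exp (R / 4) * (4 * exp (R / 4)))"
    using 1 2 3 c0 assms by (intro mult_mono) auto
  also have "\<dots> = exp (1 / 2 * R)"
    by (simp add: exp_add[symmetric])
  finally show ?thesis .
qed

section \<open>Exponential growth of the boundary gradient\<close>

theorem proposition2p3:
  assumes "CARD('n::finite) \<ge> 2"
  shows "\<exists>(b :: real ^ 'n \<Rightarrow> real ^ 'n) (f :: real ^ 'n \<Rightarrow> real).
    L_infinity b \<and> smooth_on UNIV b \<and>
    L_infinity f \<and> smooth_on UNIV f \<and> (\<exists>x. f x \<noteq> 0) \<and>
    (\<forall>q::ennreal. of_nat CARD('n) < q \<longrightarrow>
      (\<exists>c0 c0' c1 C1 C2 :: real.
        c0 > 0 \<and> c0' > 0 \<and> c1 > 0 \<and> C1 > 0 \<and> C2 > 0 \<and>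
        (\<forall>R\<ge>1. \<exists>u g. \<exists>M0::ennreal.
          M0 = Lq_norm (lebesgue_on (ball 0 R)) \<infinity> b \<and>
          unique_classical_solution R b f u \<and>
          (\<forall>x\<in>ball 0 R. u x > 0) \<and>
          grad_up_to_boundary R u g \<and>
          min (Lq_norm (sphere_measure R) \<infinity> g) (ennreal (u 0 / bdry_dist R 0))
            \<ge> ennreal (exp (c0' * R)) \<and>
          ennreal (exp (c0' * R))
            \<ge> ennreal (c0 * exp (c0 * enn2real M0 * R)
                        * R powr (1 - enn2real (of_nat CARD('n) / q)))
               * Lq_norm (lebesgue_on (ball 0 R)) q f \<and>
          ennreal c1 \<le> M0 \<and> M0 \<le> ennreal C1 \<and>
          Lq_norm (lebesgue_on (ball 0 R)) q f = ennreal C2)))"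
proof -
  let ?b = "drift :: real ^ 'n \<Rightarrow> real ^ 'n" and ?f = "source :: real ^ 'n \<Rightarrow> real"
  let ?N = "2 * real DIM(real ^ 'n) + 1"
  have f_bound: "\<And>x. norm (?f x) \<le> amplitude * real DIM(real ^ 'n) * exp (sqrt 2)"
    using abs_source_le[where 'a = "real ^ 'n"] by simp
  note f_meas = smooth_bounded_imp_L_infinity(1)[OF smooth_source f_bound]
  \<comment> \<open>Nothing in the formula ties the space of the origin in \<open>bdry_dist R 0\<close> to the space of \<open>u\<close>; matching the
    inner assertion against the goal keeps its type.\<close>
  let "\<exists>b f. _ \<and> _ \<and> _ \<and> _ \<and> _ \<and> (\<forall>q. _ \<longrightarrow> ?estimate b f q)" = ?thesis
  have main: "?estimate ?b ?f q"
    if "of_nat CARD('n) < q" for q :: ennreal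
  proof -
    have q: "q > 0" using that by (rule le_less_trans[rotated]) simp
    obtain C2 where C2: "C2 > 0" "Lq_norm (lebesgue_on (ball 0 1)) q ?f = ennreal C2"
      using Lq_norm_ball_finite_pos[OF f_meas q abs_source_le source_neq_0] by blast
    define c0 where "c0 = min (1 / (4 * ?N)) (1 / (4 * C2))"
    show ?thesis
    proof (intro exI conjI allI impI)
      show "c0 > 0" using C2 by (simp add: c0_def)
      show "(1/2 :: real) > 0" "(1/40 :: real) > 0" "?N > 0" by simp_all
      show "C2 > 0" by (rule C2)
      fix R :: real assume R: "R \<ge> 1"
      define M0 where "M0 = Lq_norm (lebesgue_on (ball 0 R)) \<infinity> ?b"
      note M0 = Lq_norm_drift[OF R, where 'a = "real ^ 'n", folded M0_def]
      show "M0 = Lq_norm (lebesgue_on (ball 0 R)) \<infinity> ?b" by (rule M0_def)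
      show "unique_classical_solution R ?b ?f (solution R)"
        using R by (intro classical_solution_unique[OF norm_drift_le] classical_solution_solution) simp
      show "\<forall>x\<in>ball (0 :: real ^ 'n) R. solution R x > 0"
        using solution_pos by blast
      have "grad (solution R) x = gradient_field x" for x :: "real ^ 'n"
        by (rule grad_laplacian_eqI(1)[OF open_UNIV UNIV_I solution_has_derivative gradient_field_has_derivative])
      then show "grad_up_to_boundary R (solution R) (gradient_field :: real ^ 'n \<Rightarrow> _)"
        by (simp add: grad_up_to_boundary_def continuous_on_gradient_field)
      show f_norm: "Lq_norm (lebesgue_on (ball 0 R)) q ?f = ennreal C2"
        using Lq_norm_ball_const[OF f_meas R source_eq_0] C2 by simp
      show "ennreal (1/40) \<le> M0" "M0 \<le> ennreal ?N" by (rule M0)+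
      obtain i :: "real ^ 'n" where i: "i \<in> Basis" using nonempty_Basis by blast
      have same: "norm (gradient_field x) = norm (gradient_field (R *\<^sub>R i))"
        if "x \<in> sphere 0 R" for x :: "real ^ 'n"
        using that i R by (simp add: gradient_field_def japanese_bracket_def dot_square_norm abs_mult)
      have "Lq_norm (sphere_measure R) \<infinity> (gradient_field :: real ^ 'n \<Rightarrow> _)
          = ennreal (norm (gradient_field (R *\<^sub>R i)))"
        using R by (intro Lq_norm_sphere_const same continuous_on_gradient_field) auto
      moreover have "exp (R / 2) \<le> norm (gradient_field (R *\<^sub>R i))"
        using i R by (intro norm_gradient_field_ge) auto
      ultimately show "ennreal (exp (1/2 * R)) \<le> min (Lq_norm (sphere_measure R) \<infinity> (gradient_field :: real ^ 'n \<Rightarrow> _))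
          (ennreal (solution R (0 :: real ^ 'n) / bdry_dist R 0))"
        using R solution_0_div_ge[OF R, where 'a = "real ^ 'n"]
        by (simp add: bdry_dist_0 ennreal_leI)
      have "enn2real M0 \<le> ?N"
        using M0(2) by (intro enn2real_leI) auto
      then have "c0 * exp (c0 * enn2real M0 * R) * R powr (1 - enn2real (of_nat CARD('n) / q)) * C2
          \<le> exp (1/2 * R)"
        unfolding c0_def using R C2 by (intro exp_linear_growth_bound) auto
      then show "ennreal (c0 * exp (c0 * enn2real M0 * R) * R powr (1 - enn2real (of_nat CARD('n) / q)))
          * Lq_norm (lebesgue_on (ball 0 R)) q ?f \<le> ennreal (exp (1/2 * R))"
        unfolding f_norm using C2 by (simp add: ennreal_mult''[symmetric] ennreal_leI)
    qed
  qed
  show ?thesis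
  proof (rule exI[of _ ?b], rule exI[of _ ?f], intro conjI allI impI)
    show "L_infinity ?b"
      by (rule smooth_bounded_imp_L_infinity(2)[OF smooth_drift norm_drift_le])
    show "L_infinity ?f"
      by (rule smooth_bounded_imp_L_infinity(2)[OF smooth_source f_bound])
    show "\<exists>x. ?f x \<noteq> 0"
      using source_neq_0[of "0 :: real ^ 'n"] by auto
    show "?estimate ?b ?f q" if "of_nat CARD('n) < q" for q
      by (rule main[OF that])
  qed (rule smooth_drift smooth_source)+
qed

end
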